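(* For all sufficiently large integers $N$, there exists in $\ell^5_N$ a linear subspace $E$ of codimension $3$ such that there is no $2$-dimensional linear subspace of $\ell^5_N$ that is orthogonal to $E$.
   Context: $\ell^5_N$ is $\mathbb R^N$ with the norm $\|x\|=\left(\sum_{i=1}^N|x_i|^5\right)^{1/5}$. For linear subspaces $X_1,X_2$ of a normed space, $X_1$ is called orthogonal to $X_2$ if $\operatorname{dist}(x,X_2)=1$ for every $x\in X_1$ with $\|x\|=1$. (The relation is not symmetric in $X_1,X_2$.) *)

theory Defs
  imports "HOL-Analysis.Analysis" "HOL-Library.Function_Algebras"
begin

instantiation "fun" :: (type, real_vector) real_vector
begin

definition scaleR_fun :: "real \<Rightarrow> ('a \<Rightarrow> 'b) \<Rightarrow> 'a \<Rightarrow> 'b"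
  where "scaleR_fun c f = (\<lambda>x. c *\<^sub>R f x)"

instance
  by standard (auto simp: scaleR_fun_def fun_eq_iff scaleR_add_right scaleR_add_left)

end

text \<open>
  The dimension \<^term>\<open>N\<close> is quantified inside the theorem, so it cannot be a type. A vector of
  \<open>\<real>\<^sup>N\<close> is encoded as a sequence whose entries outside \<open>{..<N}\<close> vanish.
\<close>

definition coord_space :: "nat \<Rightarrow> (nat \<Rightarrow> real) set"
  where "coord_space N = {x. \<forall>i\<ge>N. x i = 0}"

definition ell5_norm :: "nat \<Rightarrow> (nat \<Rightarrow> real) \<Rightarrow> real"
  where "ell5_norm N x = root 5 (\<Sum>i<N. \<bar>x i\<bar> ^ 5)"

text \<open>
  The norm is an explicit argument because \<open>\<real>\<^sup>N\<close> with the \<open>\<ell>\<^sup>5\<close> norm is a subset of a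
  type, not a type with its own norm; the library's \<^const>\<open>infdist\<close> on \<^typ>\<open>nat \<Rightarrow> real\<close> would
  refer to the product metric.
\<close>

definition norm_dist :: "('a::real_vector \<Rightarrow> real) \<Rightarrow> 'a \<Rightarrow> 'a set \<Rightarrow> real"
  where "norm_dist nrm x S = (INF y\<in>S. nrm (x - y))"

definition orthogonal_to :: "('a::real_vector \<Rightarrow> real) \<Rightarrow> 'a set \<Rightarrow> 'a set \<Rightarrow> bool"
  where "orthogonal_to nrm X1 X2 \<longleftrightarrow> (\<forall>x\<in>X1. nrm x = 1 \<longrightarrow> norm_dist nrm x X2 = 1)"

lemma subspace_coord_space: "subspace (coord_space N)"
  by (auto simp: subspace_def coord_space_def scaleR_fun_def)

lemma dim_coord_space: "dim (coord_space N) = N"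
proof -
  define e where "e i = (\<lambda>j. if j = i then 1 else 0 :: real)" for i :: nat
  have inj: "inj_on e A" for A
    by (rule inj_onI) (metis e_def zero_neq_one)
  have sum_e: "(\<Sum>i<N. c i *\<^sub>R e i) = (\<lambda>j. if j < N then c j else 0)" for c N
    by (induction N) (auto simp: e_def scaleR_fun_def fun_eq_iff zero_fun_def less_Suc_eq)
  have "independent (e ` {..<N})"
  proof (rule independent_if_scalars_zero)
    fix f x assume f: "(\<Sum>x\<in>e ` {..<N}. f x *\<^sub>R x) = 0" and x: "x \<in> e ` {..<N}"
    from x obtain k where k: "k < N" "x = e k" by auto
    have "(\<Sum>x\<in>e ` {..<N}. f x *\<^sub>R x) = (\<Sum>i<N. f (e i) *\<^sub>R e i)"
      by (simp add: sum.reindex[OF inj])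
    then have "(\<lambda>j. if j < N then f (e j) else 0) = 0"
      using f sum_e[where c="\<lambda>i. f (e i)" and N=N] by simp
    from fun_cong[OF this, of k] k show "f x = 0" by simp
  qed simp
  moreover have "e ` {..<N} \<subseteq> coord_space N"
    by (auto simp: e_def coord_space_def)
  moreover have "coord_space N \<subseteq> span (e ` {..<N})"
  proof
    fix x assume "x \<in> coord_space N"
    then have "x = (\<Sum>i<N. x i *\<^sub>R e i)"
      unfolding sum_e by (auto simp: coord_space_def fun_eq_iff)
    also have "\<dots> \<in> span (e ` {..<N})"
      by (intro span_sum span_scale span_base) auto
    finally show "x \<in> span (e ` {..<N})" .
  qed
  moreover have "card (e ` {..<N}) = N"
    by (simp add: card_image[OF inj])
  ultimately show ?thesis by (metis dim_unique)
qed

end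

theory Submission
  imports Defs "HOL-Computational_Algebra.Polynomial"
begin

text \<open>
  Write \<open>\<phi> u = u\<bar>u\<bar>\<^sup>3\<close>, so that \<open>5\<phi>\<close> is the derivative of \<open>\<bar>u\<bar>\<^sup>5\<close>. If \<open>F\<close> is orthogonal to \<open>E\<close>, the
  first-order condition gives \<open>\<Sum>\<^sub>i \<phi>(x\<^sub>i) e\<^sub>i = 0\<close> for all \<open>x \<in> F\<close> and \<open>e \<in> E\<close>. Take for \<open>E\<close> the common
  kernel of the moments \<open>\<Sum>\<^sub>i i\<^sup>k x\<^sub>i\<close>, \<open>k \<le> 2\<close>; then any four coordinates support a vector of \<open>E\<close> with four
  nonzero entries, namely a divided difference. A two-dimensional \<open>F\<close> contains \<open>x\<close>, \<open>y\<close> with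
  \<open>x\<^sub>p = y\<^sub>q = 1\<close> and \<open>x\<^sub>q = y\<^sub>p = 0\<close> for some \<open>p\<close>, \<open>q\<close>. Along \<open>x + t y\<close> the coordinate \<open>q\<close> contributes
  \<open>\<phi>(t)\<close>, which is not a polynomial near \<open>t = 0\<close>; hence among any two further coordinates one has
  \<open>x\<^sub>i = 0 \<noteq> y\<^sub>i\<close>, and by symmetry one has \<open>y\<^sub>i = 0 \<noteq> x\<^sub>i\<close>. Three further coordinates cannot satisfy this.
\<close>

section \<open>First-order condition for orthogonality\<close>

lemma has_real_derivative_abs_power5:
  "((\<lambda>u. \<bar>u\<bar> ^ 5) has_real_derivative 5 * (u * \<bar>u\<bar> ^ 3)) (at (u::real))"
proof (cases "u = 0")
  case True
  \<comment> \<open>At 0 this is Caratheodory's criterion: the factor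
    \<open>z * \<bar>z\<bar> ^ 3\<close> is continuous, and its value 0 there is the
    derivative.\<close>
  have "\<bar>z\<bar> ^ 5 = z * \<bar>z\<bar> ^ 3 * z" for z :: real
    by (cases "z \<ge> 0") (simp_all add: abs_if eval_nat_numeral)
  moreover have "isCont (\<lambda>z::real. z * \<bar>z\<bar> ^ 3) 0"
    by (intro continuous_intros)
  ultimately show ?thesis
    unfolding True by (subst CARAT_DERIV) (auto intro!: exI[of _ "\<lambda>z. z * \<bar>z\<bar> ^ 3"])
next
  case False
  then consider "u > 0" | "u < 0" by linarith
  then show ?thesis
  proof cases
    case 1
    have "((\<lambda>u. u ^ 5) has_real_derivative 5 * (u * \<bar>u\<bar> ^ 3)) (at u)"
      using 1 by (auto intro!: derivative_eq_intros simp: eval_nat_numeral)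
    then show ?thesis
      by (rule has_field_derivative_transform_within_open[where S = "{0<..}"]) (use 1 in auto)
  next
    case 2
    have "((\<lambda>u. (- u) ^ 5) has_real_derivative 5 * (u * \<bar>u\<bar> ^ 3)) (at u)"
      using 2 by (auto intro!: derivative_eq_intros simp: eval_nat_numeral)
    then show ?thesis
      by (rule has_field_derivative_transform_within_open[where S = "{..<0}"]) (use 2 in auto)
  qed
qed

lemma ell5_norm_nonneg: "0 \<le> ell5_norm N x"
  by (simp add: ell5_norm_def sum_nonneg)

lemma ell5_norm_power5: "ell5_norm N x ^ 5 = (\<Sum>i<N. \<bar>x i\<bar> ^ 5)"
  by (simp add: ell5_norm_def sum_nonneg)

lemma ell5_norm_scaleR: "ell5_norm N (c *\<^sub>R x) = \<bar>c\<bar> * ell5_norm N x"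
  by (simp add: ell5_norm_def scaleR_fun_def abs_mult power_mult_distrib real_root_mult
      real_root_power_cancel flip: sum_distrib_left)

lemma ell5_norm_eq_0_imp:
  assumes "ell5_norm N x = 0" "i < N"
  shows "x i = 0"
proof -
  have "(\<Sum>i<N. \<bar>x i\<bar> ^ 5) = 0"
    using ell5_norm_power5[of N x] assms(1) by simp
  then show ?thesis
    using assms(2) by (subst (asm) sum_nonneg_eq_0_iff) auto
qed

text \<open>Normalise \<open>x\<close> to a unit vector \<open>u\<close>. Distance 1 from
  \<open>E\<close> means that moving \<open>u\<close> along \<open>e\<close> never lowers the norm,
  so the derivative in that direction vanishes at 0.\<close>

lemma orthogonal_to_imp_sum_eq_0:
  assumes orth: "orthogonal_to (ell5_norm N) F E"
    and F: "subspace F" and E: "subspace E" and x: "x \<in> F" and e: "e \<in> E"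
  shows "(\<Sum>i<N. x i * \<bar>x i\<bar> ^ 3 * e i) = 0"
proof (cases "ell5_norm N x = 0")
  case True
  then show ?thesis by (simp add: ell5_norm_eq_0_imp)
next
  case False
  define c where "c = inverse (ell5_norm N x)"
  define u where "u = c *\<^sub>R x"
  have c: "c > 0"
    using False ell5_norm_nonneg[of N x] by (simp add: c_def)
  have "ell5_norm N u = 1"
    using False c by (simp add: u_def ell5_norm_scaleR) (simp add: c_def)
  moreover have "u \<in> F"
    using F x by (simp add: u_def subspace_scale)
  ultimately have dist: "norm_dist (ell5_norm N) u E = 1" and u1: "ell5_norm N u = 1"
    using orth by (auto simp: orthogonal_to_def)
  \<comment> \<open>The fifth power of the norm has the same minimisers and avoids differentiating
    the root.\<close>
  define f where "f t = (\<Sum>i<N. \<bar>u i - t * e i\<bar> ^ 5)" for t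
  have min: "f 0 \<le> f t" for t
  proof -
    have "norm_dist (ell5_norm N) u E \<le> ell5_norm N (u - t *\<^sub>R e)"
      unfolding norm_dist_def
      using ell5_norm_nonneg E e by (intro cINF_lower bdd_belowI2[where m = 0]) (auto simp: subspace_scale)
    then have "1 \<le> ell5_norm N (u - t *\<^sub>R e) ^ 5"
      unfolding dist by (rule one_le_power)
    also have "\<dots> = f t"
      by (simp add: ell5_norm_power5 f_def scaleR_fun_def)
    finally show ?thesis
      using ell5_norm_power5[of N u] u1 by (simp add: f_def)
  qed
  have "((\<lambda>t. \<bar>u i - t * e i\<bar> ^ 5) has_real_derivative 5 * (u i * \<bar>u i\<bar> ^ 3) * (- e i)) (at 0)" for i
  proof -
    have "((\<lambda>t. u i - t * e i) has_real_derivative - e i) (at 0)"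
      by (auto intro!: derivative_eq_intros)
    from DERIV_chain2[OF _ this, of "\<lambda>u. \<bar>u\<bar> ^ 5"] show ?thesis
      using has_real_derivative_abs_power5[of "u i"] by simp
  qed
  then have "(f has_real_derivative (\<Sum>i<N. 5 * (u i * \<bar>u i\<bar> ^ 3) * (- e i))) (at 0)"
    unfolding f_def by (intro DERIV_sum) auto
  then have "(\<Sum>i<N. 5 * (u i * \<bar>u i\<bar> ^ 3) * (- e i)) = 0"
    by (rule DERIV_local_min[where d = 1]) (auto simp: min)
  \<comment> \<open>For \<open>c > 0\<close>, replacing \<open>x\<close> by
    \<open>u = c *\<^sub>R x\<close> multiplies each \<open>x i * \<bar>x i\<bar> ^ 3\<close> by
    \<open>c ^ 4\<close>.\<close>
  also have "(\<Sum>i<N. 5 * (u i * \<bar>u i\<bar> ^ 3) * (- e i)) = - 5 * c ^ 4 * (\<Sum>i<N. x i * \<bar>x i\<bar> ^ 3 * e i)"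
    unfolding sum_distrib_left using c
    by (intro sum.cong) (auto simp: u_def scaleR_fun_def abs_mult power_mult_distrib eval_nat_numeral)
  finally show ?thesis using c by simp
qed

section \<open>The kink of the signed fourth power at 0\<close>

lemma eventually_signed_power4_eq_power4:
  fixes c d :: real
  assumes "c \<noteq> 0 \<or> d = 0"
  obtains \<sigma> where "\<forall>\<^sub>F t in nhds 0. (c + t * d) * \<bar>c + t * d\<bar> ^ 3 = \<sigma> * (c + t * d) ^ 4"
proof (cases "c = 0")
  case True
  with assms show ?thesis by (intro that[of 0]) simp
next
  case False
  have lim: "((\<lambda>t. c + t * d) \<longlongrightarrow> c) (nhds 0)"
  proof -
    have "((\<lambda>t. c + t * d) \<longlongrightarrow> c + 0 * d) (nhds 0)"
      by (intro tendsto_intros filterlim_ident)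
    then show ?thesis by simp
  qed
  have eq: "v * \<bar>v\<bar> ^ 3 = sgn v * v ^ 4" for v :: real
    by (simp add: sgn_if abs_if eval_nat_numeral)
  have "\<forall>\<^sub>F t in nhds 0. sgn (c + t * d) = sgn c"
  proof (cases "c > 0")
    case True
    have "\<forall>\<^sub>F t in nhds 0. c + t * d > 0"
      using lim True by (rule order_tendstoD)
    then show ?thesis
      using True by (auto elim!: eventually_mono)
  next
    case False
    then have "c < 0" using \<open>c \<noteq> 0\<close> by simp
    have "\<forall>\<^sub>F t in nhds 0. c + t * d < 0"
      using lim \<open>c < 0\<close> by (rule order_tendstoD)
    then show ?thesis
      using \<open>c < 0\<close> by (auto elim!: eventually_mono)
  qed
  then show ?thesis
    by (intro that[of "sgn c"]) (auto elim!: eventually_mono simp: eq)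
qed

text \<open>If neither shifted term has its kink at \<open>t = 0\<close>, then near 0 everything but
  the first term is a polynomial \<open>R\<close>. The identity for small positive \<open>t\<close>
  forces \<open>R\<close> to be \<open>- A * t ^ 4\<close>, for small negative \<open>t\<close> to
  be \<open>A * t ^ 4\<close>; hence \<open>A = 0\<close>.\<close>

lemma signed_power4_kink:
  fixes A B C D c d e f :: real
  assumes eq: "\<And>t. A * (t * \<bar>t\<bar> ^ 3) + B + C * ((c + t * d) * \<bar>c + t * d\<bar> ^ 3)
      + D * ((e + t * f) * \<bar>e + t * f\<bar> ^ 3) = 0"
    and "A \<noteq> 0"
  shows "c = 0 \<and> d \<noteq> 0 \<or> e = 0 \<and> f \<noteq> 0"
proof (rule ccontr)
  assume "\<not> ?thesis"
  then have cd: "c \<noteq> 0 \<or> d = 0" and ef: "e \<noteq> 0 \<or> f = 0" by auto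
  obtain \<sigma> where \<sigma>: "\<forall>\<^sub>F t in nhds 0. (c + t * d) * \<bar>c + t * d\<bar> ^ 3 = \<sigma> * (c + t * d) ^ 4"
    using cd by (rule eventually_signed_power4_eq_power4)
  obtain \<tau> where \<tau>: "\<forall>\<^sub>F t in nhds 0. (e + t * f) * \<bar>e + t * f\<bar> ^ 3 = \<tau> * (e + t * f) ^ 4"
    using ef by (rule eventually_signed_power4_eq_power4)
  define R where "R = [:B:] + smult (C * \<sigma>) ([:c, d:] ^ 4) + smult (D * \<tau>) ([:e, f:] ^ 4)"
  have "\<forall>\<^sub>F t in nhds 0. A * (t * \<bar>t\<bar> ^ 3) + poly R t = 0"
    using \<sigma> \<tau>
  proof eventually_elim
    case (elim t)
    then show ?case using eq[of t] by (simp add: R_def)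
  qed
  then obtain \<epsilon> where \<epsilon>: "\<epsilon> > 0" and R: "\<And>t. \<bar>t\<bar> < \<epsilon> \<Longrightarrow> A * (t * \<bar>t\<bar> ^ 3) + poly R t = 0"
    by (auto simp: eventually_nhds_metric dist_real_def)
  have "{0<..<\<epsilon>} \<subseteq> {t. poly (R + monom A 4) t = 0}"
  proof
    fix t assume "t \<in> {0<..<\<epsilon>}"
    then show "t \<in> {t. poly (R + monom A 4) t = 0}"
      using R[of t] by (simp add: poly_monom eval_nat_numeral)
  qed
  then have "infinite {t. poly (R + monom A 4) t = 0}"
    using \<epsilon> by (intro infinite_super[OF _ infinite_Ioo])
  then have p: "R + monom A 4 = 0"
    using poly_roots_finite by blast
  have "{- \<epsilon><..<0} \<subseteq> {t. poly (R - monom A 4) t = 0}"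
  proof
    fix t assume "t \<in> {- \<epsilon><..<0}"
    then show "t \<in> {t. poly (R - monom A 4) t = 0}"
      using R[of t] by (simp add: poly_monom eval_nat_numeral)
  qed
  then have "infinite {t. poly (R - monom A 4) t = 0}"
    by (rule infinite_super) (use \<epsilon> in \<open>simp add: infinite_Ioo\<close>)
  then have q: "R - monom A 4 = 0"
    using poly_roots_finite by blast
  have "monom (2 * A) 4 = (R + monom A 4) - (R - monom A 4)"
    by (simp add: add_monom)
  then show False using p q \<open>A \<noteq> 0\<close> by simp
qed

section \<open>The moment kernel and its codimension\<close>

definition moment_kernel :: "nat \<Rightarrow> (nat \<Rightarrow> real) set"
  where "moment_kernel N = {x \<in> coord_space N. \<forall>k<3. (\<Sum>i<N. real i ^ k * x i) = 0}"

lemma subspace_moment_kernel: "subspace (moment_kernel N)"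
proof -
  have "(\<Sum>i<N. real i ^ k * (c * x i)) = c * (\<Sum>i<N. real i ^ k * x i)" for k c and x :: "nat \<Rightarrow> real"
    by (simp add: sum_distrib_left mult.left_commute)
  then show ?thesis
    by (auto simp: subspace_def moment_kernel_def coord_space_def scaleR_fun_def
        distrib_left sum.distrib)
qed

text \<open>The moments of orders 0, 1, 2 form an invertible Vandermonde system at the nodes 0, 1,
  2. Hence the entries from index 3 on determine an element of the kernel.\<close>

lemma moment_kernel_eq_0:
  assumes x: "x \<in> moment_kernel N" and N: "3 \<le> N" and x0: "\<And>i. 3 \<le> i \<Longrightarrow> x i = 0"
  shows "x = 0"
proof -
  \<comment> \<open>Since \<open>0 ^ 0 = 1\<close>, entry 0 enters the moment of order 0 and no
    other.\<close>
  have *: "(\<Sum>i<N. real i ^ k * x i) = 0 ^ k * x 0 + x 1 + 2 ^ k * x 2" for k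
  proof -
    have "(\<Sum>i<N. real i ^ k * x i) = (\<Sum>i<3. real i ^ k * x i)"
      using N x0 by (intro sum.mono_neutral_right) auto
    then show ?thesis by (simp add: eval_nat_numeral)
  qed
  have k: "0 ^ k * x 0 + x 1 + 2 ^ k * x 2 = 0" if "k < 3" for k
    using x * that by (simp add: moment_kernel_def)
  have "x 0 = 0" "x 1 = 0" "x 2 = 0"
    using k[of 0] k[of 1] k[of 2] by simp_all
  then have "x i = 0" for i
    using x0[of i] by (cases "i < 3") (auto simp: eval_nat_numeral less_Suc_eq)
  then show ?thesis by (simp add: fun_eq_iff)
qed

lemma dim_moment_kernel:
  assumes N: "3 \<le> N"
  shows "dim (moment_kernel N) + 3 = N"
proof -
  \<comment> \<open>The entries at 0, 1, 2 are the negated Lagrange basis polynomials of these nodes at \<open>i\<close>.\<close>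
  define b where "b i = (\<lambda>j::nat. if j = i then 1
      else if j = 0 then - ((real i - 1) * (real i - 2) / 2)
      else if j = 1 then real i * (real i - 2)
      else if j = 2 then - (real i * (real i - 1) / 2) else 0)" for i :: nat
  have b_mem: "b i \<in> moment_kernel N" if "i \<in> {3..<N}" for i
  proof -
    have "(\<Sum>j<N. real j ^ k * b i j) = 0" if "k < 3" for k
    proof -
      have "(\<Sum>j<N. real j ^ k * b i j) = (\<Sum>j\<in>{0,1,2,i}. real j ^ k * b i j)"
        using \<open>i \<in> {3..<N}\<close> by (intro sum.mono_neutral_right) (auto simp: b_def)
      also have "\<dots> = 0"
        using that \<open>i \<in> {3..<N}\<close>
        by (auto simp: b_def eval_nat_numeral less_Suc_eq field_simps)
      finally show ?thesis .
    qed
    then show ?thesis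
      using that N by (auto simp: moment_kernel_def coord_space_def b_def)
  qed
  have inj: "inj_on b {3..<N}"
  proof (rule inj_onI)
    fix i j assume ij: "i \<in> {3..<N}" "j \<in> {3..<N}" "b i = b j"
    from fun_cong[OF ij(3), of i] ij(1,2) show "i = j"
      by (auto simp: b_def split: if_splits)
  qed
  have sum_b: "(\<Sum>i=3..<N. c i *\<^sub>R b i) j = (if j < N then c j else 0)" if "3 \<le> j" for c j
  proof -
    have "(\<Sum>i=3..<N. c i *\<^sub>R b i) j = (\<Sum>i=3..<N. c i * b i j)"
      by (induction N) (simp_all add: scaleR_fun_def)
    also have "\<dots> = (\<Sum>i=3..<N. if i = j then c j else 0)"
      using that by (intro sum.cong) (auto simp: b_def)
    finally show ?thesis using that by simp
  qed
  have "independent (b ` {3..<N})"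
  proof (rule independent_if_scalars_zero)
    fix f x assume f: "(\<Sum>x\<in>b ` {3..<N}. f x *\<^sub>R x) = 0" and x: "x \<in> b ` {3..<N}"
    from x obtain k where k: "k \<in> {3..<N}" "x = b k" by auto
    have "(\<Sum>i=3..<N. f (b i) *\<^sub>R b i) = 0"
      using f by (simp add: sum.reindex[OF inj])
    then show "f x = 0"
      using sum_b[of k "\<lambda>i. f (b i)"] k by simp
  qed simp
  moreover have "b ` {3..<N} \<subseteq> moment_kernel N"
    using b_mem by auto
  moreover have "moment_kernel N \<subseteq> span (b ` {3..<N})"
  proof
    fix x assume x: "x \<in> moment_kernel N"
    \<comment> \<open>From index 3 on each \<open>b i\<close> is a unit vector, so \<open>y\<close>
      agrees with \<open>x\<close> there and \<open>x - y\<close> falls under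
      \<open>moment_kernel_eq_0\<close>.\<close>
    define y where "y = (\<Sum>i=3..<N. x i *\<^sub>R b i)"
    have "y \<in> moment_kernel N"
      unfolding y_def using b_mem
      by (intro subspace_sum subspace_scale subspace_moment_kernel) auto
    then have "x - y \<in> moment_kernel N"
      using x by (intro subspace_diff subspace_moment_kernel)
    moreover have "(x - y) i = 0" if "3 \<le> i" for i
      using x sum_b[OF that, of x] by (auto simp: y_def moment_kernel_def coord_space_def)
    ultimately have "x - y = 0"
      using N by (intro moment_kernel_eq_0)
    then have "x = y" by simp
    also have "\<dots> \<in> span (b ` {3..<N})"
      unfolding y_def by (intro span_sum span_scale span_base) auto
    finally show "x \<in> span (b ` {3..<N})" .
  qed
  moreover have "card (b ` {3..<N}) = N - 3"
    by (simp add: card_image[OF inj])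
  ultimately have "dim (moment_kernel N) = N - 3"
    by (metis dim_unique)
  with N show ?thesis by simp
qed

section \<open>Kernel vectors with four nonzero entries\<close>

lemma divided_difference_moments:
  fixes a b c d :: real
  assumes "distinct [a, b, c, d]" "k < 3"
  shows "a ^ k / ((a - b) * (a - c) * (a - d)) + b ^ k / ((b - a) * (b - c) * (b - d))
    + c ^ k / ((c - a) * (c - b) * (c - d)) + d ^ k / ((d - a) * (d - b) * (d - c)) = 0"
proof -
  have nz: "a - b \<noteq> 0" "a - c \<noteq> 0" "a - d \<noteq> 0" "b - c \<noteq> 0" "b - d \<noteq> 0" "c - d \<noteq> 0"
    using assms(1) by auto
  define P where "P = (a - b) * (a - c) * (a - d) * (b - c) * (b - d) * (c - d)"
  have "a ^ k / ((a - b) * (a - c) * (a - d)) = a ^ k * ((b - c) * (b - d) * (c - d)) / P"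
    using nz by (simp add: P_def)
  moreover have "b ^ k / ((b - a) * (b - c) * (b - d)) = - (b ^ k) * ((a - c) * (a - d) * (c - d)) / P"
    using nz minus_diff_eq[of a b] by (simp add: P_def divide_simps) (simp add: algebra_simps)
  moreover have "c ^ k / ((c - a) * (c - b) * (c - d)) = c ^ k * ((a - b) * (a - d) * (b - d)) / P"
    using nz by (simp add: P_def divide_simps) (simp add: algebra_simps)
  moreover have "d ^ k / ((d - a) * (d - b) * (d - c)) = - (d ^ k) * ((a - b) * (a - c) * (b - c)) / P"
    using nz by (simp add: P_def divide_simps) (simp add: algebra_simps)
  \<comment> \<open>Up to sign, this is the expansion of the 4 by 4 determinant with rows of
    exponents \<open>k\<close>, 0, 1, 2 at the four nodes; for \<open>k < 3\<close> two rows
    coincide.\<close>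
  moreover have "a ^ k * ((b - c) * (b - d) * (c - d)) - b ^ k * ((a - c) * (a - d) * (c - d))
      + c ^ k * ((a - b) * (a - d) * (b - d)) - d ^ k * ((a - b) * (a - c) * (b - c)) = 0"
  proof -
    have "k = 0 \<or> k = 1 \<or> k = 2" using assms(2) by auto
    then show ?thesis
      by (elim disjE) (simp_all add: algebra_simps power2_eq_square)
  qed
  ultimately show ?thesis
    by (simp flip: add_divide_distrib diff_divide_distrib)
qed

lemma moment_kernel_four_points:
  assumes "distinct [p, q, r, s]" "{p, q, r, s} \<subseteq> {..<N}"
  obtains e where "e \<in> moment_kernel N" "e p \<noteq> 0" "e q \<noteq> 0" "e r \<noteq> 0" "e s \<noteq> 0"
    "\<And>i. i \<notin> {p, q, r, s} \<Longrightarrow> e i = 0"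
proof -
  \<comment> \<open>The weights of the divided difference at the four nodes, extended by
    zero.\<close>
  define e where "e i = (if i \<in> {p, q, r, s}
      then 1 / (\<Prod>j\<in>{p, q, r, s} - {i}. real i - real j) else 0)" for i
  have ev: "e p = 1 / ((real p - real q) * (real p - real r) * (real p - real s))"
    "e q = 1 / ((real q - real p) * (real q - real r) * (real q - real s))"
    "e r = 1 / ((real r - real p) * (real r - real q) * (real r - real s))"
    "e s = 1 / ((real s - real p) * (real s - real q) * (real s - real r))"
    using assms(1) by (auto simp: e_def insert_Diff_if)
  have "(\<Sum>i<N. real i ^ k * e i) = 0" if "k < 3" for k
  proof -
    have "(\<Sum>i<N. real i ^ k * e i) = (\<Sum>i\<in>{p, q, r, s}. real i ^ k * e i)"
      using assms(2) by (intro sum.mono_neutral_right) (auto simp: e_def)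
    also have "\<dots> = real p ^ k * e p + real q ^ k * e q + real r ^ k * e r + real s ^ k * e s"
      using assms(1) by simp
    also have "\<dots> = 0"
      using divided_difference_moments[of "real p" "real q" "real r" "real s" k] that assms(1)
      by (simp add: ev)
    finally show ?thesis .
  qed
  moreover have "e \<in> coord_space N"
    using assms(2) by (auto simp: coord_space_def e_def)
  ultimately have "e \<in> moment_kernel N"
    by (simp add: moment_kernel_def)
  moreover have "e p \<noteq> 0" "e q \<noteq> 0" "e r \<noteq> 0" "e s \<noteq> 0"
    using assms(1) by (simp_all add: ev)
  moreover have "e i = 0" if "i \<notin> {p, q, r, s}" for i
    using that by (simp add: e_def)
  ultimately show thesis
    by (rule that)
qed

section \<open>Planes orthogonal to the moment kernel\<close>

lemma orthogonal_to_moment_kernel_coordinates: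
  assumes orth: "orthogonal_to (ell5_norm N) F (moment_kernel N)"
    and F: "subspace F" and x: "x \<in> F" and y: "y \<in> F"
    and pq: "x p = 1" "x q = 0" "y p = 0" "y q = 1"
    and dist: "distinct [p, q, r, s]" "{p, q, r, s} \<subseteq> {..<N}"
  shows "x r = 0 \<and> y r \<noteq> 0 \<or> x s = 0 \<and> y s \<noteq> 0"
proof -
  obtain e where e: "e \<in> moment_kernel N" "e q \<noteq> 0" "\<And>i. i \<notin> {p, q, r, s} \<Longrightarrow> e i = 0"
    using moment_kernel_four_points[OF dist] by metis
  \<comment> \<open>Along \<open>x + t *\<^sub>R y\<close> coordinate \<open>p\<close> stays 1 and
    coordinate \<open>q\<close> equals \<open>t\<close>, so only \<open>r\<close> and
    \<open>s\<close> can cancel the kink at 0.\<close>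
  have "e q * (t * \<bar>t\<bar> ^ 3) + e p + e r * ((x r + t * y r) * \<bar>x r + t * y r\<bar> ^ 3)
      + e s * ((x s + t * y s) * \<bar>x s + t * y s\<bar> ^ 3) = 0" for t
  proof -
    define z where "z = x + t *\<^sub>R y"
    have z: "z i = x i + t * y i" for i
      by (simp add: z_def scaleR_fun_def)
    have "z \<in> F"
      unfolding z_def using F x y by (intro subspace_add subspace_scale)
    then have "0 = (\<Sum>i<N. z i * \<bar>z i\<bar> ^ 3 * e i)"
      using orthogonal_to_imp_sum_eq_0[OF orth F subspace_moment_kernel _ e(1)] by simp
    also have "\<dots> = (\<Sum>i\<in>{p, q, r, s}. z i * \<bar>z i\<bar> ^ 3 * e i)"
      using dist(2) e(3) by (intro sum.mono_neutral_right) auto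
    finally show ?thesis
      using dist(1) by (simp add: z pq algebra_simps)
  qed
  then show ?thesis
    using e(2) by (rule signed_power4_kink)
qed

text \<open>Gaussian elimination: two independent vectors of \<open>F\<close> are brought to reduced
  echelon form with pivots \<open>p\<close> and \<open>q\<close>.\<close>

lemma dim_2_dual_coordinates:
  assumes F: "subspace F" "dim F = 2" and sub: "F \<subseteq> coord_space N"
  obtains x y p q where "x \<in> F" "y \<in> F" "p < N" "q < N"
    "x p = 1" "x q = 0" "y p = 0" "y q = (1::real)"
proof -
  have "\<not> F \<subseteq> span {}"
    using F(2) dim_le_card[of F "{}"] by auto
  then obtain x0 where x0: "x0 \<in> F" "x0 \<noteq> 0" by auto
  then obtain p where p: "x0 p \<noteq> 0" by (auto simp: fun_eq_iff)
  define x1 where "x1 = inverse (x0 p) *\<^sub>R x0"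
  have x1: "x1 \<in> F" "x1 p = 1"
    using x0 p F(1) by (simp_all add: x1_def subspace_scale) (simp add: scaleR_fun_def)
  have "\<not> F \<subseteq> span {x1}"
    using F(2) dim_le_card[of F "{x1}"] by auto
  then obtain y0 where y0: "y0 \<in> F" "y0 \<notin> span {x1}" by auto
  define y1 where "y1 = y0 - y0 p *\<^sub>R x1"
  have y1: "y1 \<in> F" "y1 p = 0"
    using x1 y0 F(1) by (simp_all add: y1_def subspace_diff subspace_scale) (simp add: scaleR_fun_def)
  have "y1 \<noteq> 0"
    using y0(2) by (auto simp: y1_def span_singleton)
  then obtain q where q: "y1 q \<noteq> 0" by (auto simp: fun_eq_iff)
  define y where "y = inverse (y1 q) *\<^sub>R y1"
  have y: "y \<in> F" "y p = 0" "y q = 1"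
    using y1 q F(1) by (simp_all add: y_def subspace_scale) (simp_all add: scaleR_fun_def)
  define x where "x = x1 - x1 q *\<^sub>R y"
  have x: "x \<in> F" "x p = 1" "x q = 0"
    using x1 y F(1) by (simp_all add: x_def subspace_diff subspace_scale) (simp_all add: scaleR_fun_def)
  have "p < N" "q < N"
    using x y sub by (force simp: coord_space_def simp flip: not_le)+
  with x y show thesis using that[of x y p q] by simp
qed

theorem theorem7p8:
  shows "\<forall>\<^sub>F N in sequentially.
    \<exists>E. subspace E \<and> E \<subseteq> coord_space N \<and> dim (coord_space N) = dim E + 3 \<and>
      \<not> (\<exists>F. subspace F \<and> F \<subseteq> coord_space N \<and> dim F = 2 \<and>
             orthogonal_to (ell5_norm N) F E)"
proof (rule eventually_sequentiallyI[of 5])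
  fix N :: nat assume N: "5 \<le> N"
  have False
    if F: "subspace F" "F \<subseteq> coord_space N" "dim F = 2"
      and orth: "orthogonal_to (ell5_norm N) F (moment_kernel N)" for F
  proof -
    obtain x y p q where xy: "x \<in> F" "y \<in> F" and less: "p < N" "q < N"
      and pq: "x p = 1" "x q = 0" "y p = 0" "y q = 1"
      using dim_2_dual_coordinates[OF F(1,3,2)] by metis
    from pq have "p \<noteq> q" by auto
    \<comment> \<open>This is where 5 comes from: two pivots and three further coordinates.\<close>
    then have "3 \<le> card ({..<N} - {p, q})"
      using less N by (simp add: card_Diff_subset)
    then obtain T where T: "T \<subseteq> {..<N} - {p, q}" "card T = 3"
      by (meson obtain_subset_with_card_n)
    then obtain r s u where rsu: "T = {r, s, u}" "r \<noteq> s" "s \<noteq> u" "r \<noteq> u"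
      by (auto simp: card_3_iff)
    have "x i = 0 \<and> y i \<noteq> 0 \<or> x j = 0 \<and> y j \<noteq> 0" if "i \<in> T" "j \<in> T" "i \<noteq> j" for i j
      using T less \<open>p \<noteq> q\<close> that
      by (intro orthogonal_to_moment_kernel_coordinates[OF orth F(1) xy pq]) auto
    moreover have "y i = 0 \<and> x i \<noteq> 0 \<or> y j = 0 \<and> x j \<noteq> 0" if "i \<in> T" "j \<in> T" "i \<noteq> j" for i j
      using T less \<open>p \<noteq> q\<close> that
      by (intro orthogonal_to_moment_kernel_coordinates[OF orth F(1) xy(2,1) pq(4,3,2,1)]) auto
    \<comment> \<open>Each of the two conditions fails for at most one index of \<open>T\<close>, so
      one of the three indices satisfies both, which is contradictory.\<close>
    ultimately show False
      unfolding rsu using rsu(2-) by (metis insertCI)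
  qed
  moreover have "moment_kernel N \<subseteq> coord_space N"
    by (auto simp: moment_kernel_def)
  ultimately show "\<exists>E. subspace E \<and> E \<subseteq> coord_space N \<and> dim (coord_space N) = dim E + 3 \<and>
      \<not> (\<exists>F. subspace F \<and> F \<subseteq> coord_space N \<and> dim F = 2 \<and>
             orthogonal_to (ell5_norm N) F E)"
    using subspace_moment_kernel dim_moment_kernel[of N] N
    by (intro exI[of _ "moment_kernel N"]) (auto simp: dim_coord_space)
qed

end
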